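(* For every integer $n\ge 1$ and every integer $k$ with $0\le k\le 2n$, we have $z_{2n,k}=a_{2n-k,\,k}$.
   Context: For nonnegative integers $p,q$, let $a_{p,q}$ be the number of ways to partition a set consisting of $p$ marked points on a line and $q$ marked points on a parallel line into pairs, joining the two points of each pair by a straight segment, such that no two segments have a common point (in particular, no endpoint lies on another segment). We have $a_{0,0}=1$. The fence $Z_{2n}$ is the directed graph with vertices $u_1,\dots,u_n$ (upper) and $v_1,\dots,v_n$ (lower). Its arcs are $u_i\to v_i$ for $1\le i\le n$ and $u_i\to v_{i+1}$ for $1\le i\le n-1$. A set $A$ of vertices is closed if for every arc $x\to y$ with $x\in A$ we also have $y\in A$. $z_{2n,k}$ denotes the number of closed sets of $Z_{2n}$ with exactly $k$ elements. *)

theory Defs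
  imports "HOL-Analysis.Analysis" "Graph_Theory.Pair_Digraph"
begin

section \<open>Noncrossing perfect matchings of points on two parallel lines\<close>

text \<open>The segment joining the two points of a pair \<open>e\<close> is the closed segment \<open>convex hull e\<close>
  (see \<open>segment_convex_hull\<close>). Two points on the same line may be paired.\<close>

definition noncrossing_matchings :: "(real \<times> real) set \<Rightarrow> (real \<times> real) set set set" where
  "noncrossing_matchings S =
     {M. partition_on S M \<and> (\<forall>e\<in>M. card e = 2) \<and>
         pairwise (\<lambda>e f. convex hull e \<inter> convex hull f = {}) M}"

text \<open>The count depends only on the numbers of points on the two lines, so we fix the
  points \<open>(1,0), \<dots>, (p,0)\<close> and \<open>(1,1), \<dots>, (q,1)\<close>; the theorem
  \<open>card_noncrossing_matchings_parallel\<close> below shows that every other choice of the points and of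
  the two parallel lines gives the same number.\<close>

definition num_noncrossing :: "nat \<Rightarrow> nat \<Rightarrow> nat" where
  "num_noncrossing p q = card (noncrossing_matchings
     ((\<lambda>i. (real i, 0)) ` {1..p} \<union> (\<lambda>i. (real i, 1)) ` {1..q}))"

lemma num_noncrossing_0_0: "num_noncrossing 0 0 = 1"
proof -
  have "noncrossing_matchings {} = {{}}"
    unfolding noncrossing_matchings_def by (auto simp: partition_on_empty)
  thus ?thesis by (simp add: num_noncrossing_def)
qed

subsection \<open>Independence of the position of the points\<close>

lemma card_noncrossing_matchings_le:
  assumes fin: "finite S" and inj: "inj_on h S"
    and disj: "\<And>e f. e \<subseteq> S \<Longrightarrow> f \<subseteq> S \<Longrightarrow> card e = 2 \<Longrightarrow> card f = 2 \<Longrightarrow>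
      convex hull e \<inter> convex hull f = {} \<Longrightarrow> convex hull (h ` e) \<inter> convex hull (h ` f) = {}"
  shows "card (noncrossing_matchings S) \<le> card (noncrossing_matchings (h ` S))"
proof (rule card_inj_on_le)
  show "inj_on ((`) ((`) h)) (noncrossing_matchings S)"
  proof (rule inj_on_subset)
    show "inj_on ((`) ((`) h)) (Pow (Pow S))"
      using inj by (intro inj_on_image_Pow)
    show "noncrossing_matchings S \<subseteq> Pow (Pow S)"
      by (auto simp: noncrossing_matchings_def partition_on_def)
  qed
  show "finite (noncrossing_matchings (h ` S))"
    by (rule finite_subset[OF _ finitely_many_partition_on[of "h ` S"]])
      (use fin in \<open>auto simp: noncrossing_matchings_def\<close>)
  show "(`) ((`) h) ` noncrossing_matchings S \<subseteq> noncrossing_matchings (h ` S)"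
  proof safe
    fix M assume "M \<in> noncrossing_matchings S"
    hence M: "partition_on S M" "\<And>e. e \<in> M \<Longrightarrow> card e = 2"
      "\<And>e f. e \<in> M \<Longrightarrow> f \<in> M \<Longrightarrow> e \<noteq> f \<Longrightarrow> convex hull e \<inter> convex hull f = {}"
      by (auto simp: noncrossing_matchings_def pairwise_def)
    have sub: "e \<subseteq> S" if "e \<in> M" for e
      using that M(1) by (auto simp: partition_on_def)
    have "{} \<notin> (`) h ` M"
      using M(2) by fastforce
    hence "partition_on (h ` S) ((`) h ` M)"
      using partition_on_inj_image[OF M(1) inj] by simp
    moreover have "card (h ` e) = 2" if "e \<in> M" for e
      using M(2)[OF that] card_image[OF inj_on_subset[OF inj sub[OF that]]] by simp
    moreover have "convex hull (h ` e) \<inter> convex hull (h ` f) = {}"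
      if "e \<in> M" "f \<in> M" "h ` e \<noteq> h ` f" for e f
      using that by (intro disj sub M) auto
    ultimately show "(`) h ` M \<in> noncrossing_matchings (h ` S)"
      unfolding noncrossing_matchings_def pairwise_def by blast
  qed
qed

definition left_of :: "(real \<times> real) set \<Rightarrow> (real \<times> real) set \<Rightarrow> bool" where
  "left_of e f \<longleftrightarrow> (\<forall>(x,s)\<in>e. \<forall>(y,t)\<in>f. s = t \<longrightarrow> x < y)"

lemma left_ofI: "(\<And>x y s. (x, s) \<in> e \<Longrightarrow> (y, s) \<in> f \<Longrightarrow> x < y) \<Longrightarrow> left_of e f"
  by (auto simp: left_of_def)

lemma left_of_imp_disjoint_hulls:
  assumes "left_of {(x1,s1),(x2,s2)} {(y1,t1),(y2,t2)}"
    and "s1 \<in> {0,1}" "s2 \<in> {0,1}" "t1 \<in> {0,1}" "t2 \<in> {0,1}"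
  shows "convex hull {(x1,s1),(x2,s2)} \<inter> convex hull {(y1,t1),(y2,t2)} = {}"
proof (rule ccontr)
  assume "\<not> ?thesis"
  then obtain u v where uv: "0 \<le> u" "u \<le> 1" "0 \<le> v" "v \<le> 1"
    and x: "(1-u) * x1 + u * x2 = (1-v) * y1 + v * y2"
    and s: "(1-u) * s1 + u * s2 = (1-v) * t1 + v * t2"
    by (auto simp: segment_convex_hull[symmetric] in_segment)
  define m where "m = (\<lambda>(w::real) p q::real. (1-w) * p + w * q)"
  have m_less: "m w p q < m w p' q'" if "0 \<le> w" "w \<le> 1" "p < p'" "q < q'" for w p q p' q'
  proof -
    have "(1-w) * (p' - p) + w * (q' - q) > 0"
      using that by (cases "w = 0") (auto intro: add_nonneg_pos)
    thus ?thesis by (simp add: m_def algebra_simps)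
  qed
  have m_same: "m w p p = p" for w p by (simp add: m_def algebra_simps)
  have m_lt: "m w p q < r" if "0 \<le> w" "w \<le> 1" "p < r" "q < r" for w p q r
    using m_less[OF that] by (simp add: m_same)
  have lt_m: "r < m w p q" if "0 \<le> w" "w \<le> 1" "r < p" "r < q" for w p q r
    using m_less[OF that] by (simp add: m_same)
  have x': "m u x1 x2 = m v y1 y2" and s': "m u s1 s2 = m v t1 t2"
    using x s by (simp_all add: m_def)
  consider "s1 = s2" "t1 = t2" | "s1 = s2" "t1 \<noteq> t2" | "s1 \<noteq> s2" "t1 = t2"
    | "s1 \<noteq> s2" "t1 = s1" "t2 = s2" | "s1 \<noteq> s2" "t1 = s2" "t2 = s1"
    using assms by force
  thus False
  proof cases
    case 1
    hence "s1 = t1" using s' by (simp add: m_same)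
    hence lt: "max x1 x2 < y1" "max x1 x2 < y2"
      using assms(1) 1 by (auto simp: left_of_def)
    have "m u x1 x2 \<le> max x1 x2"
    proof -
      have "m u x1 x2 \<le> (1-u) * max x1 x2 + u * max x1 x2"
        unfolding m_def using uv by (intro add_mono mult_left_mono) auto
      thus ?thesis by (simp add: algebra_simps)
    qed
    also have "\<dots> < m v y1 y2"
      using uv lt by (intro lt_m)
    finally show False using x' by simp
  next
    case 2
    hence "m v t1 t2 = s1" using s' by (simp add: m_same)
    hence "v = 0 \<and> s1 = t1 \<or> v = 1 \<and> s1 = t2"
      using 2 assms(2-5) by (auto simp: m_def)
    thus False
    proof
      assume v: "v = 0 \<and> s1 = t1"
      hence "m u x1 x2 < y1"
        using uv 2 assms(1) by (intro m_lt) (auto simp: left_of_def)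
      thus False using x' v by (simp add: m_def)
    next
      assume v: "v = 1 \<and> s1 = t2"
      hence "m u x1 x2 < y2"
        using uv 2 assms(1) by (intro m_lt) (auto simp: left_of_def)
      thus False using x' v by (simp add: m_def)
    qed
  next
    case 3
    hence "m u s1 s2 = t1" using s' by (simp add: m_same)
    hence "u = 0 \<and> t1 = s1 \<or> u = 1 \<and> t1 = s2"
      using 3 assms(2-5) by (auto simp: m_def)
    thus False
    proof
      assume u: "u = 0 \<and> t1 = s1"
      hence "x1 < m v y1 y2"
        using uv 3 assms(1) by (intro lt_m) (auto simp: left_of_def)
      thus False using x' u by (simp add: m_def)
    next
      assume u: "u = 1 \<and> t1 = s2"
      hence "x2 < m v y1 y2"
        using uv 3 assms(1) by (intro lt_m) (auto simp: left_of_def)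
      thus False using x' u by (simp add: m_def)
    qed
  next
    case 4
    have "(u - v) * (s2 - s1) = 0" using s' 4 by (simp add: m_def algebra_simps)
    hence "v = u" using 4 by simp
    moreover have "m u x1 x2 < m u y1 y2"
      using uv 4 assms(1) by (intro m_less) (auto simp: left_of_def)
    ultimately show False using x' by simp
  next
    case 5
    have "(u - (1 - v)) * (s2 - s1) = 0" using s' 5 by (simp add: m_def algebra_simps)
    hence "v = 1 - u" using 5 by simp
    moreover have "m u x1 x2 < m u y2 y1"
      using uv 5 assms(1) by (intro m_less) (auto simp: left_of_def)
    ultimately show False using x' by (simp add: m_def)
  qed
qed

lemma disjoint_hulls_imp_left_of:
  assumes "convex hull {(x1,s1),(x2,s2)} \<inter> convex hull {(y1,t1),(y2,t2)} = {}"
    and "s1 \<in> {0,1}" "s2 \<in> {0,1}" "t1 \<in> {0,1}" "t2 \<in> {0,1}"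
  shows "left_of {(x1,s1),(x2,s2)} {(y1,t1),(y2,t2)} \<or>
         left_of {(y1,t1),(y2,t2)} {(x1,s1),(x2,s2)}"
proof -
  have pt: "((1-u) * x1 + u * x2 , (1-u) * s1 + u * s2) \<in> convex hull {(x1,s1),(x2,s2)}"
    if "0 \<le> u" "u \<le> 1" for u x1 x2 s1 s2 :: real
    using that by (auto simp: segment_convex_hull[symmetric] in_segment)
  have hor: "(w, t) \<in> convex hull {(x1,t),(x2,t)}" if "x1 \<le> w \<and> w \<le> x2 \<or> x2 \<le> w \<and> w \<le> x1"
    for w t x1 x2 :: real
  proof -
    have "w \<in> closed_segment x1 x2"
      using that by (auto simp: closed_segment_eq_real_ivl)
    then obtain u where u: "0 \<le> u" "u \<le> 1" "w = (1-u) * x1 + u * x2"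
      by (auto simp: in_segment)
    show ?thesis
      using pt[OF u(1,2), of x1 x2 t t] by (simp flip: u(3)) (simp add: algebra_simps)
  qed
  have cross: "convex hull {(x1,s),(x2,t)} \<inter> convex hull {(y1,s),(y2,t)} \<noteq> {}"
    if "x1 \<le> y1" "y2 \<le> x2" for x1 x2 y1 y2 s t :: real
  proof -
    define d where "d = (y1 - x1) + (x2 - y2)"
    define u where "u = (if d = 0 then 0 else (y1 - x1) / d)"
    have "d \<ge> 0" using that by (simp add: d_def)
    have u: "0 \<le> u" "u \<le> 1"
      using that \<open>d \<ge> 0\<close> by (auto simp: u_def d_def divide_simps)
    have "u * d = y1 - x1"
      using that by (auto simp: u_def d_def)
    hence "(1-u) * x1 + u * x2 = (1-u) * y1 + u * y2"
      by (simp add: d_def algebra_simps)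
    thus ?thesis
      using pt[OF u, of x1 x2 s t] pt[OF u, of y1 y2 s t] by (metis IntI empty_iff)
  qed
  show ?thesis
  proof (rule ccontr)
    assume nl: "\<not> ?thesis"
    have ne: "w \<notin> convex hull {(x1,s1),(x2,s2)} \<or> w \<notin> convex hull {(y1,t1),(y2,t2)}" for w
      using assms(1) by blast
    consider "s1 = s2" "t1 = t2" | "s1 = s2" "t1 \<noteq> t2" | "s1 \<noteq> s2" "t1 = t2"
      | "s1 \<noteq> s2" "t1 = s1" "t2 = s2" | "s1 \<noteq> s2" "t1 = s2" "t2 = s1"
      using assms by force
    thus False
    proof cases
      case 1
      define w where "w = max (min x1 x2) (min y1 y2)"
      have "s1 = t1" "\<not> max x1 x2 < min y1 y2" "\<not> max y1 y2 < min x1 x2"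
        using 1 nl by (auto simp: left_of_def)
      hence "x1 \<le> w \<and> w \<le> x2 \<or> x2 \<le> w \<and> w \<le> x1" "y1 \<le> w \<and> w \<le> y2 \<or> y2 \<le> w \<and> w \<le> y1"
        unfolding w_def by linarith+
      thus False using ne[of "(w, s1)"] hor 1 \<open>s1 = t1\<close> by blast
    next
      case 2
      have h: "y < min x1 x2 \<or> max x1 x2 < y" if "(y, s1) \<in> {(y1, t1), (y2, t2)}" for y
      proof (rule ccontr)
        assume "\<not> ?thesis"
        hence "x1 \<le> y \<and> y \<le> x2 \<or> x2 \<le> y \<and> y \<le> x1" by linarith
        hence "(y, s1) \<in> convex hull {(x1, s1), (x2, s2)}" using hor 2 by blast
        moreover have "(y, s1) \<in> convex hull {(y1, t1), (y2, t2)}"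
          using that by (rule hull_inc)
        ultimately show False using ne by blast
      qed
      consider "s1 = t1" | "s1 = t2" using 2 assms by auto
      thus False
      proof cases
        case 1
        thus False using 2 nl h[of y1] by (auto simp: left_of_def)
      next
        case 2
        thus False using \<open>s1 = s2\<close> \<open>t1 \<noteq> t2\<close> nl h[of y2] by (auto simp: left_of_def)
      qed
    next
      case 3
      have h: "x < min y1 y2 \<or> max y1 y2 < x" if "(x, t1) \<in> {(x1, s1), (x2, s2)}" for x
      proof (rule ccontr)
        assume "\<not> ?thesis"
        hence "y1 \<le> x \<and> x \<le> y2 \<or> y2 \<le> x \<and> x \<le> y1" by linarith
        hence "(x, t1) \<in> convex hull {(y1, t1), (y2, t2)}" using hor 3 by blast
        moreover have "(x, t1) \<in> convex hull {(x1, s1), (x2, s2)}"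
          using that by (rule hull_inc)
        ultimately show False using ne by blast
      qed
      consider "t1 = s1" | "t1 = s2" using 3 assms by auto
      thus False
      proof cases
        case 1
        thus False using 3 nl h[of x1] by (auto simp: left_of_def)
      next
        case 2
        thus False using \<open>t1 = t2\<close> \<open>s1 \<noteq> s2\<close> nl h[of x2] by (auto simp: left_of_def)
      qed
    next
      case 4
      have "\<not> (x1 < y1 \<and> x2 < y2)" "\<not> (y1 < x1 \<and> y2 < x2)"
        using 4 nl by (auto simp: left_of_def)
      hence "x1 \<le> y1 \<and> y2 \<le> x2 \<or> y1 \<le> x1 \<and> x2 \<le> y2" by linarith
      hence "convex hull {(x1,s1),(x2,s2)} \<inter> convex hull {(y1,s1),(y2,s2)} \<noteq> {}"
        using cross by (metis Int_commute)
      thus False using assms(1) 4 by simp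
    next
      case 5
      have "\<not> (x1 < y2 \<and> x2 < y1)" "\<not> (y2 < x1 \<and> y1 < x2)"
        using 5 nl by (auto simp: left_of_def)
      hence "x1 \<le> y2 \<and> y1 \<le> x2 \<or> y2 \<le> x1 \<and> x2 \<le> y1" by linarith
      hence "convex hull {(x1,s1),(x2,s2)} \<inter> convex hull {(y2,s1),(y1,s2)} \<noteq> {}"
        using cross by (metis Int_commute)
      thus False using assms(1) 5 by (simp add: insert_commute)
    qed
  qed
qed

lemma disjoint_hulls_map:
  fixes X Y :: "real set" and \<phi> \<psi> :: "real \<Rightarrow> real"
  assumes e: "e \<subseteq> X \<times> {0} \<union> Y \<times> {1}" "card e = 2" and f: "f \<subseteq> X \<times> {0} \<union> Y \<times> {1}" "card f = 2"
    and X: "strict_mono_on X \<phi>" and Y: "strict_mono_on Y \<psi>"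
    and disj: "convex hull e \<inter> convex hull f = {}"
  defines "h \<equiv> (\<lambda>(x, t::real). (if t = 0 then \<phi> x else \<psi> x, t))"
  shows "convex hull (h ` e) \<inter> convex hull (h ` f) = {}"
proof -
  have lm: "left_of (h ` e') (h ` f')" if "left_of e' f'" "e' \<in> {e, f}" "f' \<in> {e, f}" for e' f'
  proof (rule left_ofI)
    fix x y s assume "(x, s) \<in> h ` e'" "(y, s) \<in> h ` f'"
    then obtain x0 y0 where 0: "(x0, s) \<in> e'" "(y0, s) \<in> f'" "(x, s) = h (x0, s)" "(y, s) = h (y0, s)"
      by (auto simp: h_def)
    hence "x0 < y0" using that(1) by (auto simp: left_of_def)
    moreover have "(x0, s) \<in> X \<times> {0} \<union> Y \<times> {1}" "(y0, s) \<in> X \<times> {0} \<union> Y \<times> {1}"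
      using 0 that e f by auto
    ultimately show "x < y"
      using 0 X Y by (auto simp: h_def strict_mono_on_def)
  qed
  obtain x1 s1 x2 s2 where e': "e = {(x1,s1),(x2,s2)}"
    using e(2) by (metis card_2_iff surj_pair)
  obtain y1 t1 y2 t2 where f': "f = {(y1,t1),(y2,t2)}"
    using f(2) by (metis card_2_iff surj_pair)
  have st: "s1 \<in> {0,1}" "s2 \<in> {0,1}" "t1 \<in> {0,1}" "t2 \<in> {0,1}"
    using e(1) f(1) by (auto simp: e' f')
  define g where "g = (\<lambda>x (t::real). if t = 0 then \<phi> x else \<psi> x)"
  have he: "h ` e = {(g x1 s1, s1), (g x2 s2, s2)}"
    by (simp add: e' h_def g_def)
  have hf: "h ` f = {(g y1 t1, t1), (g y2 t2, t2)}"
    by (simp add: f' h_def g_def)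
  have "left_of e f \<or> left_of f e"
    unfolding e' f' by (rule disjoint_hulls_imp_left_of[OF disj[unfolded e' f'] st])
  thus ?thesis
  proof
    assume "left_of e f"
    hence "left_of (h ` e) (h ` f)" by (intro lm) simp_all
    thus ?thesis unfolding he hf by (rule left_of_imp_disjoint_hulls) (use st in blast)+
  next
    assume "left_of f e"
    hence "left_of (h ` f) (h ` e)" by (intro lm) simp_all
    hence "convex hull (h ` f) \<inter> convex hull (h ` e) = {}"
      unfolding he hf by (rule left_of_imp_disjoint_hulls) (use st in blast)+
    thus ?thesis by (simp only: Int_commute)
  qed
qed

lemma card_noncrossing_matchings_mono:
  assumes "finite X" "finite Y" and X: "strict_mono_on X \<phi>" and Y: "strict_mono_on Y \<psi>"
  shows "card (noncrossing_matchings (X \<times> {0} \<union> Y \<times> {1})) \<le>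
         card (noncrossing_matchings (\<phi> ` X \<times> {0} \<union> \<psi> ` Y \<times> {1}))"
proof -
  define h where "h = (\<lambda>(x, t::real). (if t = 0 then \<phi> x else \<psi> x, t))"
  let ?S = "X \<times> {0::real} \<union> Y \<times> {1}"
  have "inj_on h ?S"
  proof (rule inj_onI)
    fix p p' assume p: "p \<in> ?S" "p' \<in> ?S" "h p = h p'"
    obtain x s where ps: "p = (x, s)" by (cases p)
    obtain x' s' where ps': "p' = (x', s')" by (cases p')
    have "s = s'" using p(3) by (simp add: ps ps' h_def)
    moreover have "x = x'"
    proof (cases "s = 0")
      case True
      hence "x \<in> X" "x' \<in> X" "\<phi> x = \<phi> x'" using p \<open>s = s'\<close> by (simp_all add: ps ps' h_def)
      thus ?thesis using inj_onD[OF strict_mono_on_imp_inj_on[OF X]] by blast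
    next
      case False
      hence "x \<in> Y" "x' \<in> Y" "\<psi> x = \<psi> x'" using p \<open>s = s'\<close> by (simp_all add: ps ps' h_def)
      thus ?thesis using inj_onD[OF strict_mono_on_imp_inj_on[OF Y]] by blast
    qed
    ultimately show "p = p'" by (simp add: ps ps')
  qed
  hence "card (noncrossing_matchings ?S) \<le> card (noncrossing_matchings (h ` ?S))"
    using assms(1,2) disjoint_hulls_map[OF _ _ _ _ X Y, folded h_def]
    by (intro card_noncrossing_matchings_le) simp_all
  moreover have "h ` (X \<times> {0}) = \<phi> ` X \<times> {0}" "h ` (Y \<times> {1}) = \<psi> ` Y \<times> {1}"
    by (auto simp: h_def image_iff)
  ultimately show ?thesis
    by (simp only: image_Un)
qed

lemma strict_mono_on_rank:
  fixes X :: "real set"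
  assumes "finite X"
  obtains \<phi> \<phi>' :: "real \<Rightarrow> real" where "strict_mono_on X \<phi>" "\<phi> ` X = real ` {1..card X}"
    "strict_mono_on (real ` {1..card X}) \<phi>'" "\<phi>' ` real ` {1..card X} = X"
proof -
  define r where "r = (\<lambda>x. card {y\<in>X. y \<le> x})"
  have r_less: "r x < r y" if "x < y" "y \<in> X" for x y
    unfolding r_def by (rule psubset_card_mono) (use assms that in force)+
  have "inj_on r X"
    by (rule linorder_inj_onI) (use r_less in force)+
  moreover have "r x \<in> {1..card X}" if "x \<in> X" for x
    using assms that by (auto simp: r_def Suc_le_eq card_gt_0_iff intro!: card_mono)
  ultimately have img: "r ` X = {1..card X}"
    by (intro card_subset_eq) (auto simp: card_image)
  let ?\<phi> = "\<lambda>x. real (r x)"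
  have mono: "strict_mono_on X ?\<phi>"
    by (auto simp: strict_mono_on_def r_less)
  have img': "?\<phi> ` X = real ` {1..card X}"
    by (simp only: img[symmetric] image_image)
  have inj: "inj_on ?\<phi> X" using mono by (rule strict_mono_on_imp_inj_on)
  have "strict_mono_on (?\<phi> ` X) (inv_into X ?\<phi>)"
    unfolding strict_mono_on_def
  proof safe
    fix x y assume xy: "x \<in> X" "y \<in> X" "?\<phi> x < ?\<phi> y"
    hence "x < y" using r_less[of y x] by (cases x y rule: linorder_cases) auto
    moreover have "inv_into X ?\<phi> (?\<phi> x) = x" "inv_into X ?\<phi> (?\<phi> y) = y"
      by (rule inv_into_f_f[OF inj xy(1)], rule inv_into_f_f[OF inj xy(2)])
    ultimately show "inv_into X ?\<phi> (?\<phi> x) < inv_into X ?\<phi> (?\<phi> y)"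
      by (simp only:)
  qed
  moreover have "inv_into X ?\<phi> ` ?\<phi> ` X = X" using inj by simp
  ultimately show ?thesis using that mono img' by metis
qed

lemma card_noncrossing_matchings_levels:
  assumes "finite X" "finite Y"
  shows "card (noncrossing_matchings (X \<times> {0} \<union> Y \<times> {1})) = num_noncrossing (card X) (card Y)"
proof -
  obtain \<phi> \<phi>' where 1: "strict_mono_on X \<phi>" "\<phi> ` X = real ` {1..card X}"
    "strict_mono_on (real ` {1..card X}) \<phi>'" "\<phi>' ` real ` {1..card X} = X"
    using strict_mono_on_rank[OF assms(1)] by blast
  obtain \<psi> \<psi>' where 2: "strict_mono_on Y \<psi>" "\<psi> ` Y = real ` {1..card Y}"
    "strict_mono_on (real ` {1..card Y}) \<psi>'" "\<psi>' ` real ` {1..card Y} = Y"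
    using strict_mono_on_rank[OF assms(2)] by blast
  define R where "R = real ` {1..card X} \<times> {0::real} \<union> real ` {1..card Y} \<times> {1::real}"
  have "(\<lambda>i. (real i, t)) ` A = real ` A \<times> {t}" for A and t :: real by auto
  hence num: "num_noncrossing (card X) (card Y) = card (noncrossing_matchings R)"
    by (simp only: num_noncrossing_def R_def)
  have "card (noncrossing_matchings (X \<times> {0} \<union> Y \<times> {1})) \<le> card (noncrossing_matchings R)"
    using card_noncrossing_matchings_mono[OF assms 1(1) 2(1)] by (simp only: R_def 1(2) 2(2))
  moreover have "card (noncrossing_matchings R) \<le> card (noncrossing_matchings (X \<times> {0} \<union> Y \<times> {1}))"
    using card_noncrossing_matchings_mono[OF _ _ 1(3) 2(3)] by (simp only: R_def[symmetric] 1(4) 2(4) finite_imageI finite_atLeastAtMost)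
  ultimately show ?thesis
    using num by linarith
qed

theorem card_noncrossing_matchings_parallel:
  fixes c c' d :: "real \<times> real" and X Y :: "real set"
  assumes "finite X" "finite Y" and d: "d \<noteq> 0" and distinct: "\<And>t. c' \<noteq> c + t *\<^sub>R d"
  shows "card (noncrossing_matchings ((\<lambda>x. c + x *\<^sub>R d) ` X \<union> (\<lambda>y. c' + y *\<^sub>R d) ` Y)) =
         num_noncrossing (card X) (card Y)"
proof -
  define L where "L = (\<lambda>(x, t). x *\<^sub>R d + t *\<^sub>R (c' - c))"
  define h where "h = (\<lambda>p. c + L p)"
  define S where "S = X \<times> {0::real} \<union> Y \<times> {1}"
  have "linear L"
    by (rule linearI) (auto simp: L_def algebra_simps)
  have "inj L"
    unfolding linear_injective_0[OF \<open>linear L\<close>]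
  proof (intro allI impI)
    fix p assume "L p = 0"
    then obtain x t where p: "p = (x, t)" "x *\<^sub>R d + t *\<^sub>R (c' - c) = 0"
      by (cases p) (auto simp: L_def)
    have "t = 0"
    proof (rule ccontr)
      assume "t \<noteq> 0"
      have "t *\<^sub>R (c' - c) = t *\<^sub>R ((- x / t) *\<^sub>R d)"
        using p(2) \<open>t \<noteq> 0\<close> by (simp add: add_eq_0_iff)
      hence "c' - c = (- x / t) *\<^sub>R d" using \<open>t \<noteq> 0\<close> by (simp only: scaleR_cancel_left) simp
      hence "c' = c + (- x / t) *\<^sub>R d" by (metis add_diff_cancel_left' diff_add_cancel add.commute)
      thus False using distinct by blast
    qed
    moreover from this have "x = 0" using p(2) d by simp
    ultimately show "p = 0" using p(1) by (simp add: zero_prod_def)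
  qed
  hence "inj h" by (auto simp: inj_def h_def)
  have hull: "convex hull (h ` e) = h ` (convex hull e)" for e
  proof -
    have "convex hull (h ` e) = convex hull ((\<lambda>x. c + x) ` L ` e)"
      by (simp add: h_def image_image)
    also have "\<dots> = (\<lambda>x. c + x) ` L ` (convex hull e)"
      by (simp only: convex_hull_translation convex_hull_linear_image[OF \<open>linear L\<close>])
    also have "\<dots> = h ` (convex hull e)"
      by (simp add: h_def image_image)
    finally show ?thesis .
  qed
  have hS: "h ` S = (\<lambda>x. c + x *\<^sub>R d) ` X \<union> (\<lambda>y. c' + y *\<^sub>R d) ` Y"
    by (force simp: h_def L_def S_def)
  have fin: "finite S" using assms by (simp add: S_def)
  have disj: "convex hull (h ` e) \<inter> convex hull (h ` f) = {} \<longleftrightarrow> convex hull e \<inter> convex hull f = {}"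
    for e f by (simp add: hull image_Int[OF \<open>inj h\<close>, symmetric])
  have "card (noncrossing_matchings S) \<le> card (noncrossing_matchings (h ` S))"
    using fin inj_on_subset[OF \<open>inj h\<close>] disj by (intro card_noncrossing_matchings_le) auto
  moreover have "card (noncrossing_matchings (h ` S)) \<le> card (noncrossing_matchings (inv h ` h ` S))"
  proof (rule card_noncrossing_matchings_le)
    fix e f assume "e \<subseteq> h ` S" "f \<subseteq> h ` S" and ef: "convex hull e \<inter> convex hull f = {}"
    then obtain e' f' where "e = h ` e'" "f = h ` f'" by (auto simp: subset_image_iff)
    thus "convex hull (inv h ` e) \<inter> convex hull (inv h ` f) = {}"
      using ef disj \<open>inj h\<close> by (simp add: image_image)
  qed (use fin \<open>inj h\<close> in \<open>auto intro!: inj_on_inv_into\<close>)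
  ultimately show ?thesis
    using card_noncrossing_matchings_levels[OF assms(1,2)] \<open>inj h\<close>
    unfolding hS[symmetric] by (simp add: image_image S_def)
qed

section \<open>Fences and their closed sets\<close>

datatype fence_vertex = Upper nat | Lower nat

text \<open>\<open>fence n\<close> is the fence with \<open>2 * n\<close> vertices.\<close>

definition fence :: "nat \<Rightarrow> fence_vertex pair_pre_digraph" where
  "fence n =
     \<lparr> pverts = Upper ` {1..n} \<union> Lower ` {1..n},
       parcs = (\<lambda>i. (Upper i, Lower i)) ` {1..n} \<union>
               (\<lambda>i. (Upper i, Lower (i + 1))) ` {1..n-1} \<rparr>"

definition arc_closed :: "'v pair_pre_digraph \<Rightarrow> 'v set \<Rightarrow> bool" where
  "arc_closed G A \<longleftrightarrow> A \<subseteq> pverts G \<and> (\<forall>(x, y)\<in>parcs G. x \<in> A \<longrightarrow> y \<in> A)"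

definition num_arc_closed :: "'v pair_pre_digraph \<Rightarrow> nat \<Rightarrow> nat" where
  "num_arc_closed G k = card {A. arc_closed G A \<and> card A = k}"

end

(* Both sides satisfy the same recurrence.  The last edge of a noncrossing matching, seen from the
   left, joins the last two points of one of the lines or the last points of both lines; edges of
   the first two kinds may occur together, which inclusion-exclusion corrects.  On the fence, one
   removes the last arc from the upper vertex n to the lower vertex n: the correction term counts
   the closed sets of the shorter fence that contain its last upper vertex and hence force the
   lower vertex n. *)

theory Submission
  imports Defs
begin

section \<open>Noncrossing matchings on two rows\<close>

text \<open>Replaces geometry by comparisons of abscissas on each line. Edges with no line in common
  satisfy \<open>left_of\<close> vacuously in both directions, which is why horizontal edges on
  different lines never conflict.\<close>

lemma disjoint_hulls_iff_left_of:
  assumes "e \<subseteq> UNIV \<times> {0, 1}" "f \<subseteq> UNIV \<times> {0, 1}" "card e = 2" "card f = 2"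
  shows "convex hull e \<inter> convex hull f = {} \<longleftrightarrow> left_of e f \<or> left_of f e"
proof -
  obtain x1 s1 x2 s2 where e: "e = {(x1,s1),(x2,s2)}"
    using assms(3) by (metis card_2_iff surj_pair)
  obtain y1 t1 y2 t2 where f: "f = {(y1,t1),(y2,t2)}"
    using assms(4) by (metis card_2_iff surj_pair)
  have st: "s1 \<in> {0,1}" "s2 \<in> {0,1}" "t1 \<in> {0,1}" "t2 \<in> {0,1}"
    using assms(1,2) by (auto simp: e f)
  show ?thesis
  proof
    assume "convex hull e \<inter> convex hull f = {}"
    thus "left_of e f \<or> left_of f e"
      unfolding e f by (rule disjoint_hulls_imp_left_of[OF _ st])
  next
    assume "left_of e f \<or> left_of f e"
    thus "convex hull e \<inter> convex hull f = {}"
    proof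
      assume "left_of e f"
      thus ?thesis unfolding e f by (rule left_of_imp_disjoint_hulls[OF _ st])
    next
      assume "left_of f e"
      hence "convex hull f \<inter> convex hull e = {}"
        unfolding e f by (rule left_of_imp_disjoint_hulls[OF _ st(3,4,1,2)])
      thus ?thesis by (simp only: Int_commute)
    qed
  qed
qed

lemma noncrossing_matchings_two_levels_iff:
  assumes "S \<subseteq> UNIV \<times> {0, 1}"
  shows "M \<in> noncrossing_matchings S \<longleftrightarrow>
    partition_on S M \<and> (\<forall>e\<in>M. card e = 2) \<and> pairwise (\<lambda>e f. left_of e f \<or> left_of f e) M"
proof -
  have "convex hull e \<inter> convex hull f = {} \<longleftrightarrow> left_of e f \<or> left_of f e"
    if "partition_on S M" "\<forall>e\<in>M. card e = 2" "e \<in> M" "f \<in> M" for e f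
    using that assms by (intro disjoint_hulls_iff_left_of) (auto simp: partition_on_def)
  hence "pairwise (\<lambda>e f. convex hull e \<inter> convex hull f = {}) M \<longleftrightarrow>
      pairwise (\<lambda>e f. left_of e f \<or> left_of f e) M"
    if "partition_on S M" "\<forall>e\<in>M. card e = 2"
    using that by (simp add: pairwise_def)
  thus ?thesis
    unfolding noncrossing_matchings_def mem_Collect_eq by argo
qed

lemma finite_noncrossing_matchings: "finite S \<Longrightarrow> finite (noncrossing_matchings S)"
  by (rule finite_subset[OF _ finitely_many_partition_on[of S]])
    (auto simp: noncrossing_matchings_def)

section \<open>Splitting off a rightmost edge\<close>

text \<open>Since \<open>left_of\<close> quantifies over points, \<open>left_of (S - e) e\<close>
  passes to every edge inside \<open>S - e\<close>. So \<open>e\<close> is compatible with any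
  matching of the remaining points.\<close>

lemma noncrossing_matchings_insert_last:
  assumes S: "S \<subseteq> UNIV \<times> {0, 1}" and e: "e \<subseteq> S" "card e = 2" and last: "left_of (S - e) e"
  shows "{M \<in> noncrossing_matchings S. e \<in> M} = insert e ` noncrossing_matchings (S - e)"
proof (intro equalityI subsetI)
  fix M assume "M \<in> {M \<in> noncrossing_matchings S. e \<in> M}"
  hence M: "partition_on S M" "\<forall>f\<in>M. card f = 2" "e \<in> M"
    "pairwise (\<lambda>e f. left_of e f \<or> left_of f e) M"
    using noncrossing_matchings_two_levels_iff[OF S] by auto
  have "\<Union>(M - {e}) = S - e"
    using M(1,3) by (auto simp: partition_on_def disjoint_def)
  hence "partition_on (S - e) (M - {e})"
    using M(1) by (auto simp: partition_on_def disjoint_def)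
  hence "M - {e} \<in> noncrossing_matchings (S - e)"
    using M S by (subst noncrossing_matchings_two_levels_iff) (auto simp: pairwise_def)
  thus "M \<in> insert e ` noncrossing_matchings (S - e)"
    using M(3) by (metis imageI insert_Diff)
next
  fix M assume "M \<in> insert e ` noncrossing_matchings (S - e)"
  then obtain N where MN: "M = insert e N" and "N \<in> noncrossing_matchings (S - e)" by blast
  hence N: "partition_on (S - e) N" "\<forall>f\<in>N. card f = 2"
    "pairwise (\<lambda>e f. left_of e f \<or> left_of f e) N"
    using noncrossing_matchings_two_levels_iff[of "S - e"] S by auto
  have sub: "f \<subseteq> S - e" if "f \<in> N" for f
    using that N(1) by (auto simp: partition_on_def)
  have "left_of f e" if "f \<in> N" for f
    using sub[OF that] last by (fastforce simp: left_of_def)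
  hence "pairwise (\<lambda>e f. left_of e f \<or> left_of f e) M"
    using N(3) by (auto simp: MN pairwise_insert)
  moreover have "partition_on S M"
    using N(1) e sub unfolding MN partition_on_def by (auto simp: disjoint_def)
  ultimately show "M \<in> {M \<in> noncrossing_matchings S. e \<in> M}"
    using N(2) e S by (simp add: noncrossing_matchings_two_levels_iff MN)
qed

text \<open>Blocks of a partition of \<open>S - e\<close> lie in \<open>S - e\<close>, so the
  nonempty \<open>e\<close> is never among them, and inserting it can be undone.\<close>

lemma inj_on_insert_noncrossing_matchings:
  assumes "e \<noteq> {}"
  shows "inj_on (insert e) (noncrossing_matchings (S - e))"
proof (rule inj_on_subset)
  show "inj_on (insert e) {M. e \<notin> M}"
    by (auto simp: inj_on_def)
  show "noncrossing_matchings (S - e) \<subseteq> {M. e \<notin> M}"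
    using assms by (auto simp: noncrossing_matchings_def partition_on_def)
qed

lemma card_noncrossing_matchings_insert_last:
  assumes "S \<subseteq> UNIV \<times> {0, 1}" "e \<subseteq> S" "card e = 2" "left_of (S - e) e"
  shows "card {M \<in> noncrossing_matchings S. e \<in> M} = card (noncrossing_matchings (S - e))"
proof -
  have "e \<noteq> {}" using assms(3) by auto
  thus ?thesis
    by (simp add: noncrossing_matchings_insert_last[OF assms] card_image
        inj_on_insert_noncrossing_matchings)
qed

text \<open>Once \<open>e\<close> is split off, \<open>f\<close> is still to the right of what
  remains, so it can be split off as well. This evaluates the overlap term of the
  inclusion-exclusion.\<close>

lemma card_noncrossing_matchings_insert_last_two:
  assumes S: "S \<subseteq> UNIV \<times> {0, 1}" and e: "e \<subseteq> S" "card e = 2" "left_of (S - e) e"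
    and f: "f \<subseteq> S" "card f = 2" "left_of (S - f) f" and disj: "e \<inter> f = {}"
  shows "card {M \<in> noncrossing_matchings S. e \<in> M \<and> f \<in> M} = card (noncrossing_matchings (S - e - f))"
proof -
  have ne: "e \<noteq> {}" "e \<noteq> f" using e(2) f(2) disj by auto
  have "{M \<in> noncrossing_matchings S. e \<in> M \<and> f \<in> M} =
      {M \<in> noncrossing_matchings S. e \<in> M} \<inter> {M. f \<in> M}"
    by blast
  also have "\<dots> = insert e ` {M \<in> noncrossing_matchings (S - e). f \<in> M}"
    unfolding noncrossing_matchings_insert_last[OF S e] using ne(2) by auto
  also have "card \<dots> = card {M \<in> noncrossing_matchings (S - e). f \<in> M}"
    by (intro card_image inj_on_subset[OF inj_on_insert_noncrossing_matchings[OF ne(1)]]) auto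
  also have "\<dots> = card (noncrossing_matchings (S - e - f))"
    using S f disj by (intro card_noncrossing_matchings_insert_last) (auto simp: left_of_def)
  finally show ?thesis .
qed

text \<open>A point strictly between the endpoints would lie on some other edge \<open>g\<close>,
  and either direction of \<open>left_of\<close> would put \<open>w\<close> before \<open>y\<close>
  or after \<open>z\<close>. Hence, unlike with arcs, pairs on one line cannot be nested.\<close>

lemma noncrossing_matching_edge_gap:
  assumes S: "S \<subseteq> UNIV \<times> {0, 1}" and M: "M \<in> noncrossing_matchings S"
    and f: "{(y, t), (z, t)} \<in> M" and yz: "y < w" "w < z"
  shows "(w, t) \<notin> S"
proof
  assume "(w, t) \<in> S"
  have M': "partition_on S M" "pairwise (\<lambda>e f. left_of e f \<or> left_of f e) M"
    using M noncrossing_matchings_two_levels_iff[OF S] by auto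
  obtain g where g: "g \<in> M" "(w, t) \<in> g"
    using \<open>(w, t) \<in> S\<close> M'(1) by (auto simp: partition_on_def)
  have "g \<noteq> {(y, t), (z, t)}" using g(2) yz by auto
  hence "left_of g {(y, t), (z, t)} \<or> left_of {(y, t), (z, t)} g"
    using M'(2) g(1) f by (auto simp: pairwise_def)
  thus False using g(2) yz by (force simp: left_of_def)
qed

section \<open>The standard point set and the recurrence for matchings\<close>

definition two_rows :: "nat \<Rightarrow> nat \<Rightarrow> (real \<times> real) set" where
  "two_rows p q = (\<lambda>i. (real i, 0)) ` {1..p} \<union> (\<lambda>i. (real i, 1)) ` {1..q}"

lemma num_noncrossing_two_rows: "num_noncrossing p q = card (noncrossing_matchings (two_rows p q))"
  by (simp add: num_noncrossing_def two_rows_def)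

lemma two_rows_levels: "two_rows p q \<subseteq> UNIV \<times> {0, 1}"
  by (auto simp: two_rows_def)

lemma finite_two_rows: "finite (two_rows p q)"
  by (simp add: two_rows_def)

lemma two_rows_iff:
  "(x, t) \<in> two_rows p q \<longleftrightarrow>
    (t = 0 \<and> (\<exists>i. x = real i \<and> 1 \<le> i \<and> i \<le> p)) \<or> (t = 1 \<and> (\<exists>i. x = real i \<and> 1 \<le> i \<and> i \<le> q))"
  by (auto simp: two_rows_def)

text \<open>If the last point of a line were matched on its line with anything but its neighbour,
  that neighbour would lie in the gap of the edge. The hypothesis \<open>row\<close> treats both
  lines at once, \<open>m\<close> being the number of points at height \<open>t\<close>.\<close>

lemma two_rows_last_pair:
  assumes M: "M \<in> noncrossing_matchings (two_rows p q)"
    and row: "t = 0 \<and> m = p \<or> t = 1 \<and> m = q"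
    and f: "f \<in> M" "(real m, t) \<in> f" "f \<subseteq> UNIV \<times> {t}"
  shows "f = {(real m - 1, t), (real m, t)}"
proof -
  have S: "partition_on (two_rows p q) M" "card f = 2"
    using M f(1) by (auto simp: noncrossing_matchings_def)
  have fsub: "f \<subseteq> two_rows p q" using S(1) f(1) by (auto simp: partition_on_def)
  obtain a where a: "f = {a, (real m, t)}" "a \<noteq> (real m, t)"
    using S(2) f(2) by (auto simp: card_2_iff)
  have "a \<in> two_rows p q" "snd a = t" using fsub f(3) a(1) by auto
  then obtain i where i: "a = (real i, t)" "1 \<le> i" "i \<le> m"
    using row by (cases a) (auto simp: two_rows_iff)
  have "i < m" using a(2) i by (cases "i = m") auto
  moreover have "\<not> i < m - 1"
  proof
    assume "i < m - 1"
    moreover from this have "real i < real m - 1" "real (m - 1) = real m - 1"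
      by (auto simp: of_nat_diff)
    moreover from \<open>i < m - 1\<close> have "(real (m - 1), t) \<in> two_rows p q"
      unfolding two_rows_iff using row by (metis Suc_leI diff_le_self not_less_zero neq0_conv One_nat_def)
    ultimately show False
      using noncrossing_matching_edge_gap[OF two_rows_levels M, of "real i" t "real m" "real (m - 1)"]
        a(1) i(1) f(1) by simp
  qed
  \<comment> \<open>\<open>m \<ge> 1\<close> makes the truncated difference agree with
    \<open>real m - 1\<close>.\<close>
  ultimately have "i = m - 1" "m \<ge> 1" by auto
  thus ?thesis using a(1) i(1) by (simp add: of_nat_diff)
qed

text \<open>Compare the edges through the two rightmost points. If they differ, one is left of the
  other, and the right one cannot touch the line whose last point belongs to the left one; so it is
  horizontal and joins two neighbours.\<close>

lemma two_rows_last_edge: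
  assumes M: "M \<in> noncrossing_matchings (two_rows p q)" and pos: "p + q > 0"
  shows "{(real p, 0), (real q, 1)} \<in> M \<or> {(real p - 1, 0), (real p, 0)} \<in> M \<or>
         {(real q - 1, 1), (real q, 1)} \<in> M"
proof -
  have part: "partition_on (two_rows p q) M" and card2: "\<forall>e\<in>M. card e = 2"
    and pw: "pairwise (\<lambda>e f. left_of e f \<or> left_of f e) M"
    using M noncrossing_matchings_two_levels_iff[OF two_rows_levels] by auto
  have sub: "f \<subseteq> two_rows p q" if "f \<in> M" for f
    using that part by (auto simp: partition_on_def)
  have cover: "\<exists>f\<in>M. a \<in> f" if "a \<in> two_rows p q" for a
    using that part by (auto simp: partition_on_def)
  show ?thesis
  proof (cases "p = 0 \<or> q = 0")
    case True
    \<comment> \<open>With one line empty, \<open>t\<close> is the height of the other, so every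
      edge is horizontal.\<close>
    then obtain m t where mt: "t = 0 \<and> m = p \<or> t = 1 \<and> m = q" "two_rows p q \<subseteq> UNIV \<times> {t::real}" "m > 0"
    proof
      assume "p = 0"
      thus thesis using pos by (intro that[of 1 q]) (auto simp: two_rows_def)
    next
      assume "q = 0"
      thus thesis using pos by (intro that[of 0 p]) (auto simp: two_rows_def)
    qed
    hence "(real m, t) \<in> two_rows p q" by (auto simp: two_rows_iff)
    then obtain f where "f \<in> M" "(real m, t) \<in> f" using cover by blast
    thus ?thesis using two_rows_last_pair[OF M mt(1)] sub[of f] mt by auto
  next
    case False
    then obtain e f where e: "e \<in> M" "(real p, 0) \<in> e" and f: "f \<in> M" "(real q, 1) \<in> f"
      using cover[of "(real p, 0)"] cover[of "(real q, 1)"] by (auto simp: two_rows_iff)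
    show ?thesis
    proof (cases "e = f")
      case True
      have "{(real p, 0), (real q, 1)} = e"
        using True e f card2 by (intro card_subset_eq) (auto intro: card_ge_0_finite)
      thus ?thesis using e by simp
    next
      case False
      hence "left_of e f \<or> left_of f e" using pw e f by (auto simp: pairwise_def)
      thus ?thesis
      proof
        assume "left_of e f"
        hence "(x, 0) \<notin> f" for x
          using e(2) sub[OF f(1)] by (fastforce simp: left_of_def two_rows_iff)
        hence "f \<subseteq> UNIV \<times> {1}" using sub[OF f(1)] two_rows_levels[of p q] by fastforce
        thus ?thesis using two_rows_last_pair[OF M _ f] f by auto
      next
        assume "left_of f e"
        hence "(x, 1) \<notin> e" for x
          using f(2) sub[OF e(1)] by (fastforce simp: left_of_def two_rows_iff)
        hence "e \<subseteq> UNIV \<times> {0}" using sub[OF e(1)] two_rows_levels[of p q] by fastforce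
        thus ?thesis using two_rows_last_pair[OF M _ e] e by auto
      qed
    qed
  qed
qed

text \<open>Deleting at the right end leaves a set of the same shape, which closes the recursion.
  "Upper" refers to the line of the first argument, at height 0.\<close>

lemma two_rows_diff_upper:
  assumes "p \<ge> 2"
  shows "two_rows p q - {(real p - 1, 0), (real p, 0)} = two_rows (p - 2) q"
proof -
  obtain r where r: "p = Suc (Suc r)"
    using assms by (metis One_nat_def Suc_1 add_2_eq_Suc le_Suc_ex)
  have "two_rows p q = {(real p - 1, 0), (real p, 0)} \<union> two_rows r q"
    by (simp add: two_rows_def r atLeastAtMostSuc_conv insert_commute add.commute)
  moreover have "{(real p - 1, 0), (real p, 0)} \<inter> two_rows r q = {}"
    by (auto simp: two_rows_iff r)
  ultimately show ?thesis by (simp add: Un_Diff Diff_triv r inf_commute)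
qed

lemma two_rows_diff_lower:
  assumes "q \<ge> 2"
  shows "two_rows p q - {(real q - 1, 1), (real q, 1)} = two_rows p (q - 2)"
proof -
  obtain r where r: "q = Suc (Suc r)"
    using assms by (metis One_nat_def Suc_1 add_2_eq_Suc le_Suc_ex)
  have "two_rows p q = {(real q - 1, 1), (real q, 1)} \<union> two_rows p r"
    by (simp add: two_rows_def r atLeastAtMostSuc_conv insert_commute add.commute)
  moreover have "{(real q - 1, 1), (real q, 1)} \<inter> two_rows p r = {}"
    by (auto simp: two_rows_iff r)
  ultimately show ?thesis by (simp add: Un_Diff Diff_triv r inf_commute)
qed

lemma two_rows_diff_transversal:
  assumes "p \<ge> 1" "q \<ge> 1"
  shows "two_rows p q - {(real p, 0), (real q, 1)} = two_rows (p - 1) (q - 1)"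
proof -
  obtain r s where rs: "p = Suc r" "q = Suc s"
    using assms by (metis One_nat_def Suc_le_D)
  have "two_rows p q = {(real p, 0), (real q, 1)} \<union> two_rows r s"
    by (simp add: two_rows_def rs atLeastAtMostSuc_conv insert_commute add.commute)
  moreover have "{(real p, 0), (real q, 1)} \<inter> two_rows r s = {}"
    by (auto simp: two_rows_iff rs)
  ultimately show ?thesis by (simp add: Un_Diff Diff_triv rs inf_commute)
qed

text \<open>The overlap of the two horizontal cases stands on the left to avoid subtraction in
  \<open>nat\<close>. The guards give the value 0 where an index would be negative, instead of the
  truncated one.\<close>

lemma num_noncrossing_rec:
  assumes "p + q > 0"
  shows "num_noncrossing p q + (if p \<ge> 2 \<and> q \<ge> 2 then num_noncrossing (p - 2) (q - 2) else 0) =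
    (if p \<ge> 2 then num_noncrossing (p - 2) q else 0) +
    (if q \<ge> 2 then num_noncrossing p (q - 2) else 0) +
    (if p \<ge> 1 \<and> q \<ge> 1 then num_noncrossing (p - 1) (q - 1) else 0)"
proof -
  define S where "S = two_rows p q"
  define a where "a = {(real p - 1, 0::real), (real p, 0)}"
  define b where "b = {(real q - 1, 1::real), (real q, 1)}"
  define c where "c = {(real p, 0::real), (real q, 1)}"
  define E where "E = (\<lambda>e. {M \<in> noncrossing_matchings S. e \<in> M})"
  have S: "S \<subseteq> UNIV \<times> {0, 1}" by (simp add: S_def two_rows_levels)
  have card2: "card a = 2" "card b = 2" "card c = 2" by (simp_all add: a_def b_def c_def)
  \<comment> \<open>Abscissas start at 1, so for \<open>p \<le> 1\<close> the left endpoint of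
    \<open>a\<close> lies outside \<open>S\<close>; then \<open>E a\<close> is empty, in accordance
    with the guard.\<close>
  have aS: "a \<subseteq> S \<longleftrightarrow> p \<ge> 2"
  proof
    assume "a \<subseteq> S"
    then obtain i where "real p - 1 = real i" "i \<ge> 1" by (auto simp: a_def S_def two_rows_iff)
    thus "p \<ge> 2" by linarith
  next
    assume "p \<ge> 2"
    thus "a \<subseteq> S" by (auto simp: a_def S_def two_rows_iff intro!: exI[of _ "p - 1"])
  qed
  have bS: "b \<subseteq> S \<longleftrightarrow> q \<ge> 2"
  proof
    assume "b \<subseteq> S"
    then obtain i where "real q - 1 = real i" "i \<ge> 1" by (auto simp: b_def S_def two_rows_iff)
    thus "q \<ge> 2" by linarith
  next
    assume "q \<ge> 2"
    thus "b \<subseteq> S" by (auto simp: b_def S_def two_rows_iff intro!: exI[of _ "q - 1"])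
  qed
  have cS: "c \<subseteq> S \<longleftrightarrow> p \<ge> 1 \<and> q \<ge> 1" by (auto simp: c_def S_def two_rows_iff)
  have last_a: "left_of (S - a) a" if "p \<ge> 2"
    unfolding S_def a_def two_rows_diff_upper[OF that]
    using that by (auto simp: left_of_def two_rows_iff)
  have last_b: "left_of (S - b) b" if "q \<ge> 2"
    unfolding S_def b_def two_rows_diff_lower[OF that]
    using that by (auto simp: left_of_def two_rows_iff)
  have last_c: "left_of (S - c) c" if "p \<ge> 1" "q \<ge> 1"
    unfolding S_def c_def two_rows_diff_transversal[OF that]
    using that by (auto simp: left_of_def two_rows_iff)
  have E_empty: "E e = {}" if "\<not> e \<subseteq> S" for e
    using that by (auto simp: E_def noncrossing_matchings_def partition_on_def)
  have fin: "finite (E e)" for e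
    using finite_noncrossing_matchings[OF finite_two_rows] by (simp add: E_def S_def)

  have a: "card (E a) = (if p \<ge> 2 then num_noncrossing (p - 2) q else 0)"
  proof (cases "p \<ge> 2")
    case True
    have "card (E a) = card (noncrossing_matchings (S - a))" unfolding E_def
      using True aS by (intro card_noncrossing_matchings_insert_last S card2 last_a) auto
    thus ?thesis using True by (simp add: S_def a_def two_rows_diff_upper num_noncrossing_two_rows)
  qed (use aS E_empty in simp)
  have b: "card (E b) = (if q \<ge> 2 then num_noncrossing p (q - 2) else 0)"
  proof (cases "q \<ge> 2")
    case True
    have "card (E b) = card (noncrossing_matchings (S - b))" unfolding E_def
      using True bS by (intro card_noncrossing_matchings_insert_last S card2 last_b) auto
    thus ?thesis using True by (simp add: S_def b_def two_rows_diff_lower num_noncrossing_two_rows)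
  qed (use bS E_empty in simp)
  have c: "card (E c) = (if p \<ge> 1 \<and> q \<ge> 1 then num_noncrossing (p - 1) (q - 1) else 0)"
  proof (cases "p \<ge> 1 \<and> q \<ge> 1")
    case True
    have "card (E c) = card (noncrossing_matchings (S - c))" unfolding E_def
      using True cS by (intro card_noncrossing_matchings_insert_last S card2 last_c) auto
    thus ?thesis using True
      by (simp add: S_def c_def two_rows_diff_transversal num_noncrossing_two_rows)
  next
    case False
    hence "E c = {}" using cS E_empty by blast
    thus ?thesis using False by auto
  qed
  have ab: "card (E a \<inter> E b) = (if p \<ge> 2 \<and> q \<ge> 2 then num_noncrossing (p - 2) (q - 2) else 0)"
  proof (cases "p \<ge> 2 \<and> q \<ge> 2")
    case True
    have "E a \<inter> E b = {M \<in> noncrossing_matchings S. a \<in> M \<and> b \<in> M}" by (auto simp: E_def)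
    also have "card \<dots> = card (noncrossing_matchings (S - a - b))"
      using True aS bS
      by (intro card_noncrossing_matchings_insert_last_two S card2 last_a last_b)
        (auto simp: a_def b_def)
    finally show ?thesis using True
      by (simp add: S_def a_def b_def two_rows_diff_upper two_rows_diff_lower
          num_noncrossing_two_rows)
  next
    case False
    hence "E a \<inter> E b = {}" using aS bS E_empty by blast
    thus ?thesis using False by auto
  qed

  \<comment> \<open>Distinct blocks of a partition are disjoint. As \<open>c\<close> meets both
    \<open>a\<close> and \<open>b\<close>, only the pair \<open>a\<close>, \<open>b\<close> needs a
    correction.\<close>
  have "E e \<inter> E c = {}" if "e \<inter> c \<noteq> {}" "e \<noteq> c" for e
    using that by (auto simp: E_def noncrossing_matchings_def partition_on_def disjoint_def)
  moreover have "a \<inter> c \<noteq> {}" "b \<inter> c \<noteq> {}" "a \<noteq> c" "b \<noteq> c"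
    by (auto simp: a_def b_def c_def doubleton_eq_iff)
  ultimately have disj: "(E a \<union> E b) \<inter> E c = {}" by blast
  have "noncrossing_matchings S = (E a \<union> E b) \<union> E c"
    using two_rows_last_edge[OF _ assms] by (auto simp: E_def S_def a_def b_def c_def)
  hence "num_noncrossing p q = card (E a \<union> E b) + card (E c)"
    using disj fin by (simp add: num_noncrossing_two_rows S_def card_Un_disjoint)
  moreover have "card (E a) + card (E b) = card (E a \<union> E b) + card (E a \<inter> E b)"
    using fin by (intro card_Un_Int)
  ultimately show ?thesis using a b c ab by linarith
qed

section \<open>Closed sets of the fence\<close>

lemma finite_fence: "finite (pverts (fence n))"
  by (simp add: fence_def)

lemma card_pverts_fence: "card (pverts (fence n)) = 2 * n"
proof -
  have "card (pverts (fence n)) = card (Upper ` {1..n}) + card (Lower ` {1..n})"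
    unfolding fence_def by (simp, intro card_Un_disjoint) auto
  thus ?thesis by (simp add: card_image inj_on_def)
qed

lemma arc_closed_fence_iff:
  "arc_closed (fence n) A \<longleftrightarrow> A \<subseteq> Upper ` {1..n} \<union> Lower ` {1..n} \<and>
    (\<forall>i\<in>{1..n}. Upper i \<in> A \<longrightarrow> Lower i \<in> A) \<and> (\<forall>i\<in>{1..n-1}. Upper i \<in> A \<longrightarrow> Lower (i + 1) \<in> A)"
  by (auto simp: arc_closed_def fence_def)

lemma finite_arc_closed_fence: "finite {A. arc_closed (fence n) A \<and> P A}"
  by (rule finite_subset[of _ "Pow (pverts (fence n))"])
    (auto simp: arc_closed_def finite_fence)

text \<open>Supplies the zeros that match the guards on the matching side when the size exceeds the
  fence.\<close>

lemma num_arc_closed_fence_eq_0: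
  assumes "k > 2 * n"
  shows "num_arc_closed (fence n) k = 0"
proof -
  have "card A \<le> 2 * n" if "arc_closed (fence n) A" for A
    using that card_mono[OF finite_fence] by (auto simp: arc_closed_def card_pverts_fence)
  hence "{A. arc_closed (fence n) A \<and> card A = k} = {}" using assms by force
  thus ?thesis by (simp only: num_arc_closed_def card.empty)
qed

lemma num_arc_closed_fence_0: "num_arc_closed (fence 0) 0 = 1"
proof -
  have "{A. arc_closed (fence 0) A \<and> card A = 0} = {{}}"
    by (auto simp: arc_closed_fence_iff)
  thus ?thesis by (simp add: num_arc_closed_def)
qed

section \<open>Removing the last two vertices and the recurrence for closed sets\<close>

lemma fence_vertices_Suc:
  "Upper ` {1..Suc n} \<union> Lower ` {1..Suc n} =
    insert (Upper (Suc n)) (insert (Lower (Suc n)) (Upper ` {1..n} \<union> Lower ` {1..n}))"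
  by (auto simp: atLeastAtMostSuc_conv)

text \<open>Both \<open>Upper (Suc n)\<close> and, if it exists, \<open>Upper n\<close> have an arc
  to the missing vertex, so both are excluded.\<close>

lemma arc_closed_fence_Suc_notin:
  assumes "Lower (Suc n) \<notin> A"
  shows "arc_closed (fence (Suc n)) A \<longleftrightarrow> arc_closed (fence n) A \<and> Upper n \<notin> A"
proof -
  \<comment> \<open>Settles \<open>n = 0\<close>: indices start at 1, so \<open>Upper 0\<close> is
    not a vertex.\<close>
  have "Upper 0 \<notin> A" if "A \<subseteq> Upper ` {1..m} \<union> Lower ` {1..m}" for m
    using that by auto
  thus ?thesis
    using assms unfolding arc_closed_fence_iff fence_vertices_Suc
    by (cases n) (auto simp: atLeastAtMostSuc_conv)
qed

text \<open>\<open>Lower (Suc n)\<close> is a sink: its presence satisfies the arcs into it and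
  imposes nothing else.\<close>

lemma arc_closed_fence_Suc_Lower:
  assumes "Lower (Suc n) \<in> A" "Upper (Suc n) \<notin> A"
  shows "arc_closed (fence (Suc n)) A \<longleftrightarrow> arc_closed (fence n) (A - {Lower (Suc n)})"
  using assms unfolding arc_closed_fence_iff fence_vertices_Suc
  by (cases n) (auto simp: atLeastAtMostSuc_conv)

text \<open>The only arc leaving \<open>Upper (Suc n)\<close> goes to \<open>Lower (Suc n)\<close>,
  so the two vertices can be removed together.\<close>

lemma arc_closed_fence_Suc_Upper:
  assumes "Lower (Suc n) \<in> A" "Upper (Suc n) \<in> A"
  shows "arc_closed (fence (Suc n)) A \<longleftrightarrow>
    arc_closed (fence n) (A - {Upper (Suc n), Lower (Suc n)})"
  using assms unfolding arc_closed_fence_iff fence_vertices_Suc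
  by (cases n) (auto simp: atLeastAtMostSuc_conv)

text \<open>Common counting step: \<open>V\<close> holds the prescribed vertices, \<open>W\<close>
  the forbidden ones, and \<open>A \<mapsto> A - V\<close> is a bijection with inverse
  \<open>A \<mapsto> A \<union> V\<close>.\<close>

lemma card_arc_closed_containing:
  assumes iff: "\<And>A. V \<subseteq> A \<Longrightarrow> A \<inter> W = {} \<Longrightarrow> arc_closed G A \<longleftrightarrow> arc_closed H (A - V)"
    and "finite V" and fin: "finite (pverts H)" and disj: "V \<inter> W = {}" "(V \<union> W) \<inter> pverts H = {}"
  shows "card {A. arc_closed G A \<and> V \<subseteq> A \<and> A \<inter> W = {} \<and> card A = k} =
    (if k \<ge> card V then num_arc_closed H (k - card V) else 0)"
proof -
  let ?L = "{A. arc_closed G A \<and> V \<subseteq> A \<and> A \<inter> W = {} \<and> card A = k}"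
  have finA: "finite A" "A \<inter> (V \<union> W) = {}" if "arc_closed H A" for A
    using that fin disj finite_subset[of A "pverts H"] by (auto simp: arc_closed_def)
  \<comment> \<open>Finiteness comes from \<open>A - V\<close> being closed in the finite graph
    \<open>H\<close>; it excludes the default \<open>card\<close> of infinite sets.\<close>
  have L: "card A = card (A - V) + card V" if "A \<in> ?L" for A
  proof -
    have "finite (A - V)" using that iff finA by blast
    hence "card ((A - V) \<union> V) = card (A - V) + card V"
      using \<open>finite V\<close> by (intro card_Un_disjoint) auto
    moreover have "(A - V) \<union> V = A" using that by auto
    ultimately show ?thesis by simp
  qed
  show ?thesis
  proof (cases "k \<ge> card V")
    case True
    have "bij_betw (\<lambda>A. A - V) ?L {A. arc_closed H A \<and> card A = k - card V}"
    proof (rule bij_betwI[where g = "\<lambda>A. A \<union> V"])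
      show "(\<lambda>A. A - V) \<in> ?L \<rightarrow> {A. arc_closed H A \<and> card A = k - card V}"
      proof
        fix A assume "A \<in> ?L"
        thus "A - V \<in> {A. arc_closed H A \<and> card A = k - card V}"
          using L[of A] iff[of A] by simp
      qed
      show "(\<lambda>A. A \<union> V) \<in> {A. arc_closed H A \<and> card A = k - card V} \<rightarrow> ?L"
      proof
        fix A assume A: "A \<in> {A. arc_closed H A \<and> card A = k - card V}"
        hence "A \<inter> V = {}" "A \<inter> W = {}" "finite A" using finA[of A] by auto
        hence eq: "(A \<union> V) - V = A" "(A \<union> V) \<inter> W = {}" "card (A \<union> V) = card A + card V"
          using disj \<open>finite V\<close> by (auto simp: card_Un_disjoint)
        thus "A \<union> V \<in> ?L" using A iff[of "A \<union> V"] True by auto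
      qed
      show "(A \<union> V) - V = A" if "A \<in> {A. arc_closed H A \<and> card A = k - card V}" for A
        using that finA[of A] by auto
    qed auto
    thus ?thesis using True by (simp add: bij_betw_same_card num_arc_closed_def)
  next
    case False
    have "A \<notin> ?L" for A using L[of A] False by auto
    hence "?L = {}" by blast
    thus ?thesis using False by (simp only: card.empty if_False)
  qed
qed

text \<open>The upper vertex forces the lower one, so two elements are prescribed. Used for the
  fence at hand and, one size down, for the correction term.\<close>

lemma card_arc_closed_fence_last_Upper:
  "card {A. arc_closed (fence (Suc n)) A \<and> Upper (Suc n) \<in> A \<and> card A = k} =
    (if k \<ge> 2 then num_arc_closed (fence n) (k - 2) else 0)"
proof -
  have "{A. arc_closed (fence (Suc n)) A \<and> Upper (Suc n) \<in> A \<and> card A = k} =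
      {A. arc_closed (fence (Suc n)) A \<and> {Upper (Suc n), Lower (Suc n)} \<subseteq> A \<and> A \<inter> {} = {} \<and> card A = k}"
    by (auto simp: arc_closed_fence_iff)
  also have "card \<dots> = (if k \<ge> card {Upper (Suc n), Lower (Suc n)} then
      num_arc_closed (fence n) (k - card {Upper (Suc n), Lower (Suc n)}) else 0)"
    by (rule card_arc_closed_containing)
      (auto simp: arc_closed_fence_Suc_Upper finite_fence, auto simp: fence_def)
  finally show ?thesis by (simp add: numeral_2_eq_2)
qed

text \<open>Closed sets are split by which of the last two vertices they contain: none, only the
  lower one, or both.\<close>

lemma num_arc_closed_fence_rec:
  "num_arc_closed (fence (Suc n)) k +
      (if n \<ge> 1 \<and> k \<ge> 2 then num_arc_closed (fence (n - 1)) (k - 2) else 0) =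
    num_arc_closed (fence n) k + (if k \<ge> 1 then num_arc_closed (fence n) (k - 1) else 0) +
    (if k \<ge> 2 then num_arc_closed (fence n) (k - 2) else 0)"
proof -
  let ?C = "\<lambda>n P. {A. arc_closed (fence n) A \<and> P A \<and> card A = k}"
  let ?u = "Upper (Suc n)" and ?v = "Lower (Suc n)"
  have lower: "card (?C (Suc n) (\<lambda>A. ?v \<in> A \<and> ?u \<notin> A)) =
      (if k \<ge> 1 then num_arc_closed (fence n) (k - 1) else 0)"
  proof -
    have "?C (Suc n) (\<lambda>A. ?v \<in> A \<and> ?u \<notin> A) =
        {A. arc_closed (fence (Suc n)) A \<and> {?v} \<subseteq> A \<and> A \<inter> {?u} = {} \<and> card A = k}" by auto
    also have "card \<dots> = (if k \<ge> card {?v} then num_arc_closed (fence n) (k - card {?v}) else 0)"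
      by (rule card_arc_closed_containing)
        (auto simp: arc_closed_fence_Suc_Lower finite_fence, auto simp: fence_def)
    finally show ?thesis by simp
  qed
  \<comment> \<open>Only closed sets of the shorter fence without \<open>Upper n\<close> survive
    when \<open>?v\<close> is absent; the others form the correction.\<close>
  have old: "num_arc_closed (fence n) k =
      card (?C n (\<lambda>A. Upper n \<notin> A)) + card (?C n (\<lambda>A. Upper n \<in> A))"
  proof -
    have "{A. arc_closed (fence n) A \<and> card A = k} =
        ?C n (\<lambda>A. Upper n \<notin> A) \<union> ?C n (\<lambda>A. Upper n \<in> A)" by auto
    thus ?thesis unfolding num_arc_closed_def
      by (simp only:) (rule card_Un_disjoint; auto simp: finite_arc_closed_fence)
  qed
  have old_in: "card (?C n (\<lambda>A. Upper n \<in> A)) =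
      (if n \<ge> 1 \<and> k \<ge> 2 then num_arc_closed (fence (n - 1)) (k - 2) else 0)"
  proof (cases n)
    case 0
    hence "?C n (\<lambda>A. Upper n \<in> A) = {}" by (auto simp: arc_closed_fence_iff)
    thus ?thesis using 0 by (simp only: card.empty) simp
  next
    case (Suc m)
    thus ?thesis using card_arc_closed_fence_last_Upper[of m k] by simp
  qed
  have notin: "?C (Suc n) (\<lambda>A. ?v \<notin> A) = ?C n (\<lambda>A. Upper n \<notin> A)"
  proof -
    have "?v \<notin> A" if "arc_closed (fence n) A" for A
      using that by (auto simp: arc_closed_fence_iff)
    thus ?thesis using arc_closed_fence_Suc_notin[of n] by blast
  qed
  have "{A. arc_closed (fence (Suc n)) A \<and> card A = k} = ?C (Suc n) (\<lambda>A. ?v \<notin> A) \<union>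
      (?C (Suc n) (\<lambda>A. ?v \<in> A \<and> ?u \<notin> A) \<union> ?C (Suc n) (\<lambda>A. ?u \<in> A))"
    by (auto simp: arc_closed_fence_iff)
  moreover have "card (?C (Suc n) (\<lambda>A. ?v \<notin> A) \<union>
      (?C (Suc n) (\<lambda>A. ?v \<in> A \<and> ?u \<notin> A) \<union> ?C (Suc n) (\<lambda>A. ?u \<in> A))) =
      card (?C (Suc n) (\<lambda>A. ?v \<notin> A)) +
      (card (?C (Suc n) (\<lambda>A. ?v \<in> A \<and> ?u \<notin> A)) + card (?C (Suc n) (\<lambda>A. ?u \<in> A)))"
    by (subst card_Un_disjoint; (subst card_Un_disjoint)?)
      (auto simp: finite_arc_closed_fence arc_closed_fence_iff)
  ultimately have "num_arc_closed (fence (Suc n)) k = card (?C n (\<lambda>A. Upper n \<notin> A)) +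
      (card (?C (Suc n) (\<lambda>A. ?v \<in> A \<and> ?u \<notin> A)) + card (?C (Suc n) (\<lambda>A. ?u \<in> A)))"
    unfolding num_arc_closed_def notin by (simp only:)
  thus ?thesis
    using old old_in lower card_arc_closed_fence_last_Upper[of n k] by linarith
qed

section \<open>Comparison of the two recurrences\<close>

text \<open>Strong induction, because the correction term goes back two fence sizes;
  \<open>k\<close> varies since the terms have sizes \<open>k\<close>, \<open>k - 1\<close> and
  \<open>k - 2\<close>.\<close>

lemma num_arc_closed_fence_eq_num_noncrossing:
  "k \<le> 2 * n \<Longrightarrow> num_arc_closed (fence n) k = num_noncrossing (2 * n - k) k"
proof (induction n arbitrary: k rule: less_induct)
  case (less n)
  show ?case
  proof (cases n)
    case 0
    thus ?thesis using less.prems by (simp add: num_arc_closed_fence_0 num_noncrossing_0_0)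
  next
    case (Suc m)
    define p where "p = 2 * n - k"
    have pk: "p + k = 2 * Suc m" using less.prems Suc by (simp add: p_def)
    \<comment> \<open>Extended by 0 to all \<open>j\<close>, so that the range condition turns into
      the guard on \<open>p\<close> in each term below.\<close>
    have IH: "num_arc_closed (fence l) j = (if j \<le> 2 * l then num_noncrossing (2 * l - j) j else 0)"
      if "l < n" for l j
      using less.IH[OF that] num_arc_closed_fence_eq_0[of l j] by auto
    have t1: "num_arc_closed (fence m) k = (if p \<ge> 2 then num_noncrossing (p - 2) k else 0)"
    proof -
      have "2 * m - k = p - 2" "k \<le> 2 * m \<longleftrightarrow> p \<ge> 2" using pk by auto
      thus ?thesis using IH[of m k] Suc by simp
    qed
    have t2: "(if k \<ge> 1 then num_arc_closed (fence m) (k - 1) else 0) =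
        (if p \<ge> 1 \<and> k \<ge> 1 then num_noncrossing (p - 1) (k - 1) else 0)"
    proof (cases "k \<ge> 1")
      case True
      have "2 * m - (k - 1) = p - 1" "k - 1 \<le> 2 * m \<longleftrightarrow> p \<ge> 1" using pk True by auto
      thus ?thesis using IH[of m "k - 1"] Suc True by simp
    qed simp
    have t3: "(if k \<ge> 2 then num_arc_closed (fence m) (k - 2) else 0) =
        (if k \<ge> 2 then num_noncrossing p (k - 2) else 0)"
    proof (cases "k \<ge> 2")
      case True
      have "2 * m - (k - 2) = p" "k - 2 \<le> 2 * m" using pk True by auto
      thus ?thesis using IH[of m "k - 2"] Suc True by simp
    qed simp
    have t4: "(if m \<ge> 1 \<and> k \<ge> 2 then num_arc_closed (fence (m - 1)) (k - 2) else 0) =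
        (if p \<ge> 2 \<and> k \<ge> 2 then num_noncrossing (p - 2) (k - 2) else 0)"
    proof (cases "m \<ge> 1 \<and> k \<ge> 2")
      case True
      have "2 * (m - 1) - (k - 2) = p - 2" "k - 2 \<le> 2 * (m - 1) \<longleftrightarrow> p \<ge> 2" using pk True by auto
      thus ?thesis using IH[of "m - 1" "k - 2"] Suc True by simp
    next
      case False
      \<comment> \<open>If both were at least 2, then \<open>p + k \<ge> 4\<close> would give
        \<open>m \<ge> 1\<close>; so the differently phrased guards agree.\<close>
      hence "\<not> (p \<ge> 2 \<and> k \<ge> 2)" using pk by auto
      thus ?thesis using False by auto
    qed
    have "p + k > 0" using pk by simp
    from num_noncrossing_rec[OF this] num_arc_closed_fence_rec[of m k]
    show ?thesis unfolding t1 t2 t3 t4 Suc p_def[unfolded Suc, symmetric] by linarith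
  qed
qed

theorem theorem3:
  fixes n k :: nat
  assumes "n \<ge> 1" and "k \<le> 2 * n"
  shows "num_arc_closed (fence n) k = num_noncrossing (2 * n - k) k"
  using assms(2) by (rule num_arc_closed_fence_eq_num_noncrossing)

end
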